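(* Let $M$ be an ordered $\Gamma$-groupoid, let $\mu,\sigma$ be fuzzy subsets of $M$, and let $t\in[0,1]$. (i) If $\mu$ and $\sigma$ are fuzzy left (resp. fuzzy right) ideals of $M$ and the level subset $(\mu\times\sigma)_t$ is nonempty, then $(\mu\times\sigma)_t$ is a left (resp. right) ideal of $M\times M$. (ii) If $\mu$ and $\sigma$ are fuzzy ideals of $M$ and the level subset $(\mu\times\sigma)_t$ is nonempty, then $(\mu\times\sigma)_t$ is an ideal of $M\times M$.
   Context: Let $M,\Gamma$ be nonempty sets. $M$ is a $\Gamma$-groupoid if there is a well-defined operation $M\times\Gamma\times M\to M$, $(a,\gamma,b)\mapsto a\gamma b$ (no associativity assumed). An ordered $\Gamma$-groupoid is a $\Gamma$-groupoid $M$ with a partial order $\le$ on $M$ such that $a\le b$ implies $a\gamma c\le b\gamma c$ and $c\gamma a\le c\gamma b$ for all $c\in M$, $\gamma\in\Gamma$. $M\times M$ is an ordered $\Gamma$-groupoid under $(a,b)\gamma(c,d):=(a\gamma c,b\gamma d)$ and the componentwise order: $(a,b)\le(c,d)$ iff $a\le c$ and $b\le d$. A nonempty subset $A$ of an ordered $\Gamma$-groupoid $N$ is a left (resp. right) ideal of $N$ if (1) $x\gamma a\in A$ (resp. $a\gamma x\in A$) for all $x\in N,\gamma\in\Gamma,a\in A$, and (2) $a\in A$, $b\in N$, $b\le a$ imply $b\in A$. It is an ideal if it is both a left and a right ideal. A fuzzy subset of $N$ is any mapping $\mu:N\to[0,1]$. It is a fuzzy left (resp. right) ideal of $N$ if (1)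 $\mu(x\gamma y)\ge\mu(y)$ (resp. $\mu(x\gamma y)\ge\mu(x)$) for all $x,y\in N$, $\gamma\in\Gamma$, and (2) $x\le y$ implies $\mu(x)\ge\mu(y)$. It is a fuzzy ideal if it is both a fuzzy left and a fuzzy right ideal. For fuzzy subsets $\mu,\sigma$ of $M$, $\mu\times\sigma$ is the fuzzy subset of $M\times M$ given by $(\mu\times\sigma)(x,y):=\min\{\mu(x),\sigma(y)\}$. For a fuzzy subset $f$ of $N$ and $t\in[0,1]$, the level subset is $f_t:=\{x\in N\mid f(x)\ge t\}$. *)

theory Defs
  imports Complex_Main
begin

record ('a, 'g) gamma_structure =
  carrier :: "'a set"
  gammas :: "'g set"
  op :: "'a \<Rightarrow> 'g \<Rightarrow> 'a \<Rightarrow> 'a"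
  ord :: "'a rel"

definition gamma_groupoid :: "('a, 'g) gamma_structure \<Rightarrow> bool" where
  "gamma_groupoid N \<longleftrightarrow>
     carrier N \<noteq> {} \<and> gammas N \<noteq> {} \<and>
     (\<forall>a\<in>carrier N. \<forall>\<gamma>\<in>gammas N. \<forall>b\<in>carrier N. op N a \<gamma> b \<in> carrier N)"

definition ordered_gamma_groupoid :: "('a, 'g) gamma_structure \<Rightarrow> bool" where
  "ordered_gamma_groupoid N \<longleftrightarrow>
     gamma_groupoid N \<and> partial_order_on (carrier N) (ord N) \<and>
     (\<forall>a\<in>carrier N. \<forall>b\<in>carrier N. (a, b) \<in> ord N \<longrightarrow>
        (\<forall>c\<in>carrier N. \<forall>\<gamma>\<in>gammas N.
           (op N a \<gamma> c, op N b \<gamma> c) \<in> ord N \<and> (op N c \<gamma> a, op N c \<gamma> b) \<in> ord N))"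

definition square :: "('a, 'g) gamma_structure \<Rightarrow> ('a \<times> 'a, 'g) gamma_structure" where
  "square M =
     \<lparr> carrier = carrier M \<times> carrier M,
       gammas = gammas M,
       op = (\<lambda>(a, b) \<gamma> (c, d). (op M a \<gamma> c, op M b \<gamma> d)),
       ord = {((a, b), (c, d)) | a b c d. (a, c) \<in> ord M \<and> (b, d) \<in> ord M} \<rparr>"

lemma ordered_gamma_groupoid_square:
  assumes "ordered_gamma_groupoid M"
  shows "ordered_gamma_groupoid (square M)"
proof -
  have po: "partial_order_on (carrier M) (ord M)"
    using assms by (simp add: ordered_gamma_groupoid_def)
  have "refl_on (carrier (square M)) (ord (square M))"
    using partial_order_onD(1)[OF po] by (auto simp: refl_on_def square_def)
  moreover have "trans (ord (square M))"
    using partial_order_onD(2)[OF po] by (auto simp: square_def intro!: transI dest: transD)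
  moreover have "antisym (ord (square M))"
    using partial_order_onD(3)[OF po] by (auto simp: square_def intro!: antisymI dest: antisymD)
  moreover have "ord (square M) \<subseteq> carrier (square M) \<times> carrier (square M)"
    using partial_order_onD(4)[OF po] by (auto simp: square_def)
  ultimately have "partial_order_on (carrier (square M)) (ord (square M))"
    by (simp add: partial_order_on_def preorder_on_def)
  then show ?thesis
    using assms by (auto simp: ordered_gamma_groupoid_def gamma_groupoid_def square_def)
qed

definition left_ideal :: "('a, 'g) gamma_structure \<Rightarrow> 'a set \<Rightarrow> bool" where
  "left_ideal N A \<longleftrightarrow>
     A \<noteq> {} \<and> A \<subseteq> carrier N \<and>
     (\<forall>x\<in>carrier N. \<forall>\<gamma>\<in>gammas N. \<forall>a\<in>A. op N x \<gamma> a \<in> A) \<and>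
     (\<forall>a\<in>A. \<forall>b\<in>carrier N. (b, a) \<in> ord N \<longrightarrow> b \<in> A)"

definition right_ideal :: "('a, 'g) gamma_structure \<Rightarrow> 'a set \<Rightarrow> bool" where
  "right_ideal N A \<longleftrightarrow>
     A \<noteq> {} \<and> A \<subseteq> carrier N \<and>
     (\<forall>x\<in>carrier N. \<forall>\<gamma>\<in>gammas N. \<forall>a\<in>A. op N a \<gamma> x \<in> A) \<and>
     (\<forall>a\<in>A. \<forall>b\<in>carrier N. (b, a) \<in> ord N \<longrightarrow> b \<in> A)"

definition ideal :: "('a, 'g) gamma_structure \<Rightarrow> 'a set \<Rightarrow> bool" where
  "ideal N A \<longleftrightarrow> left_ideal N A \<and> right_ideal N A"

text \<open>A fuzzy subset is a total HOL function of which only the values on the carrier matter;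
  all notions below are relativised to the carrier.\<close>

definition fuzzy_subset :: "('a, 'g) gamma_structure \<Rightarrow> ('a \<Rightarrow> real) \<Rightarrow> bool" where
  "fuzzy_subset N \<mu> \<longleftrightarrow> (\<forall>x\<in>carrier N. \<mu> x \<in> {0..1})"

definition fuzzy_left_ideal :: "('a, 'g) gamma_structure \<Rightarrow> ('a \<Rightarrow> real) \<Rightarrow> bool" where
  "fuzzy_left_ideal N \<mu> \<longleftrightarrow>
     fuzzy_subset N \<mu> \<and>
     (\<forall>x\<in>carrier N. \<forall>y\<in>carrier N. \<forall>\<gamma>\<in>gammas N. \<mu> (op N x \<gamma> y) \<ge> \<mu> y) \<and>
     (\<forall>x\<in>carrier N. \<forall>y\<in>carrier N. (x, y) \<in> ord N \<longrightarrow> \<mu> x \<ge> \<mu> y)"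

definition fuzzy_right_ideal :: "('a, 'g) gamma_structure \<Rightarrow> ('a \<Rightarrow> real) \<Rightarrow> bool" where
  "fuzzy_right_ideal N \<mu> \<longleftrightarrow>
     fuzzy_subset N \<mu> \<and>
     (\<forall>x\<in>carrier N. \<forall>y\<in>carrier N. \<forall>\<gamma>\<in>gammas N. \<mu> (op N x \<gamma> y) \<ge> \<mu> x) \<and>
     (\<forall>x\<in>carrier N. \<forall>y\<in>carrier N. (x, y) \<in> ord N \<longrightarrow> \<mu> x \<ge> \<mu> y)"

definition fuzzy_ideal :: "('a, 'g) gamma_structure \<Rightarrow> ('a \<Rightarrow> real) \<Rightarrow> bool" where
  "fuzzy_ideal N \<mu> \<longleftrightarrow> fuzzy_left_ideal N \<mu> \<and> fuzzy_right_ideal N \<mu>"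

definition fuzzy_times :: "('a \<Rightarrow> real) \<Rightarrow> ('a \<Rightarrow> real) \<Rightarrow> 'a \<times> 'a \<Rightarrow> real" where
  "fuzzy_times \<mu> \<sigma> = (\<lambda>(x, y). min (\<mu> x) (\<sigma> y))"

lemma fuzzy_subset_fuzzy_times:
  "fuzzy_subset M \<mu> \<Longrightarrow> fuzzy_subset M \<sigma> \<Longrightarrow> fuzzy_subset (square M) (fuzzy_times \<mu> \<sigma>)"
  by (auto simp: fuzzy_subset_def fuzzy_times_def square_def min_def)

definition level_subset :: "('a, 'g) gamma_structure \<Rightarrow> ('a \<Rightarrow> real) \<Rightarrow> real \<Rightarrow> 'a set" where
  "level_subset N f t = {x \<in> carrier N. f x \<ge> t}"

end

theory Submission
  imports Defs
begin

text \<open>The claim splits into two independent facts. Operation and order on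
  \<open>square M\<close> act componentwise and \<open>min\<close> is monotone in each argument, so
  the inequalities for \<mu> and \<sigma> combine into the same inequalities for
  \<open>fuzzy_times \<mu> \<sigma>\<close>: the product inherits each one-sided fuzzy ideal
  property. And over any \<Gamma>-groupoid, a nonempty level subset of a one-sided fuzzy ideal is an
  ideal on that side (\<open>left_ideal_level_subset\<close>,
  \<open>right_ideal_level_subset\<close>). The two-sided case is the conjunction of the one-sided
  ones.\<close>

lemma fuzzy_left_ideal_fuzzy_times:
  assumes "fuzzy_left_ideal M \<mu>" and "fuzzy_left_ideal M \<sigma>"
  shows "fuzzy_left_ideal (square M) (fuzzy_times \<mu> \<sigma>)"
  using assms fuzzy_subset_fuzzy_times[of M \<mu> \<sigma>]
  unfolding fuzzy_left_ideal_def
  by (auto simp: square_def fuzzy_times_def intro: min.coboundedI1 min.coboundedI2)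

lemma fuzzy_right_ideal_fuzzy_times:
  assumes "fuzzy_right_ideal M \<mu>" and "fuzzy_right_ideal M \<sigma>"
  shows "fuzzy_right_ideal (square M) (fuzzy_times \<mu> \<sigma>)"
  using assms fuzzy_subset_fuzzy_times[of M \<mu> \<sigma>]
  unfolding fuzzy_right_ideal_def
  by (auto simp: square_def fuzzy_times_def intro: min.coboundedI1 min.coboundedI2)

text \<open>Multiplying on the left or passing to a smaller element never lowers \<open>f\<close>,
  so the bound \<open>t\<close> survives by transitivity. Since \<open>level_subset\<close> is cut
  down to the carrier, products must also stay in it; this is what \<open>gamma_groupoid N\<close>
  supplies.\<close>

lemma left_ideal_level_subset:
  assumes "gamma_groupoid N" and "fuzzy_left_ideal N f" and "level_subset N f t \<noteq> {}"
  shows "left_ideal N (level_subset N f t)"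
  using assms unfolding left_ideal_def level_subset_def fuzzy_left_ideal_def gamma_groupoid_def
  by (auto intro: order_trans)

lemma right_ideal_level_subset:
  assumes "gamma_groupoid N" and "fuzzy_right_ideal N f" and "level_subset N f t \<noteq> {}"
  shows "right_ideal N (level_subset N f t)"
  using assms unfolding right_ideal_def level_subset_def fuzzy_right_ideal_def gamma_groupoid_def
  by (auto intro: order_trans)

theorem corollary17:
  fixes M :: "('a, 'g) gamma_structure" and \<mu> \<sigma> :: "'a \<Rightarrow> real" and t :: real
  assumes "ordered_gamma_groupoid M"
    and "fuzzy_subset M \<mu>" and "fuzzy_subset M \<sigma>"
    and "t \<in> {0..1}"
  shows "(fuzzy_left_ideal M \<mu> \<and> fuzzy_left_ideal M \<sigma> \<and>
            level_subset (square M) (fuzzy_times \<mu> \<sigma>) t \<noteq> {} \<longrightarrow>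
            left_ideal (square M) (level_subset (square M) (fuzzy_times \<mu> \<sigma>) t))
       \<and> (fuzzy_right_ideal M \<mu> \<and> fuzzy_right_ideal M \<sigma> \<and>
            level_subset (square M) (fuzzy_times \<mu> \<sigma>) t \<noteq> {} \<longrightarrow>
            right_ideal (square M) (level_subset (square M) (fuzzy_times \<mu> \<sigma>) t))
       \<and> (fuzzy_ideal M \<mu> \<and> fuzzy_ideal M \<sigma> \<and>
            level_subset (square M) (fuzzy_times \<mu> \<sigma>) t \<noteq> {} \<longrightarrow>
            ideal (square M) (level_subset (square M) (fuzzy_times \<mu> \<sigma>) t))"
proof -
  \<comment> \<open>The level subset lemmas are applied with \<open>N\<close> =
    \<open>square M\<close>, so closure of the componentwise operation is needed there.\<close>
  have "gamma_groupoid (square M)"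
    using ordered_gamma_groupoid_square[OF assms(1)] by (simp add: ordered_gamma_groupoid_def)
  then show ?thesis
    unfolding ideal_def fuzzy_ideal_def
    by (simp add: left_ideal_level_subset right_ideal_level_subset
        fuzzy_left_ideal_fuzzy_times fuzzy_right_ideal_fuzzy_times)
qed

end
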